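(* Let $s\ge 2$, let $\mathfrak{f}_{2,s}$ be the free nilpotent Lie algebra of step $s$ on two generators, let $n=\dim\mathfrak{f}_{2,s}$, and let $X_1,\dots,X_n$ be its Hall basis, with associated monomials $p_3,\dots,p_n$ in $x_1,\dots,x_n$ and constants $c_3,\dots,c_n$. For $j\in\{3,\dots,n\}$ consider the equation $$c_jx_1\Bigl(\frac{\partial p_j}{\partial x_2}+\sum_{k=3}^n p_k\frac{\partial p_j}{\partial x_k}\Bigr)+\sum_{\ell=3}^n p_\ell\frac{\partial r_j}{\partial x_\ell}=0\qquad(\ast_j)$$ for an unknown function $r_j=r_j(x_3,\dots,x_n)$. If $s\le 8$, then for every $j\in\{3,\dots,n\}$ equation $(\ast_j)$ admits a solution of the form $$r_j(x_3,\dots,x_n)=\sum_{k=3}^n a_k^jx_k+\sum_{\ell=3}^n b_\ell^jx_\ell^2$$ for some $a_k^j,b_\ell^j\in\mathbb{R}$. In particular, if $s\le5$, then $b_\ell^j=0$. Vice versa, if $s\ge9$, then there is $j\in\{3,\dots,n\}$ such that, for every choice of real numbers $a_k^j,b_\ell^j$, the function $\sum_{k=3}^n a_k^jx_k+\sum_{\ell=3}^n b_\ell^jx_\ell^2$ does not solve $(\ast_j)$.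
   Context: Hall basis of $\mathfrak{f}_{2,s}$: each basis element is an iterated bracket of the generators $X_1,X_2$, and its length is the number of generators in it. The generators are the basis elements of length $1$, with $X_1<X_2$. Once basis elements of lengths $1,\dots,\ell-1$ have been defined and totally ordered so that $X<Y$ whenever $\mathrm{length}(X)<\mathrm{length}(Y)$, a bracket $[X,Y]$ with $\mathrm{length}(X)+\mathrm{length}(Y)=\ell$ (where $\ell\le s$) is a basis element of length $\ell$ if (1) $X$ and $Y$ are basis elements and $X>Y$, and (2) if $X=[Z,W]$, then $Y\ge W$. Basis elements are numbered increasingly: $X_3=[X_2,X_1]$, $X_4=[X_3,X_1]$, $X_5=[X_3,X_2]$, $X_6=[X_4,X_1]$, $X_7=[X_4,X_2]$, $X_8=[X_5,X_2]$, and so on (with a fixed order among the elements of each larger length). For $i\ge3$, repeatedly expanding the left entry of the bracket gives a unique expression $$X_i=[[\dots[[X_2,X_{i_1}],X_{i_2}],\dots,X_{i_{m-1}}],X_{i_m}],$$ with $i_1=1$ and $i_l\le i_{l+1}$. Put $d(i)=m$ (the number of brackets in this expansion) and $I(i)=(a_1,\dots,a_n)$, where $a_r=\#\{t:i_t=r\}$. For $j\ge3$ define the monomial $$p_j(x)=\frac{(-1)^{d(j)}}{I(j)!}\,x^{I(j)},\qquad x^{I(j)}=x_1^{a_1}\cdots x_n^{a_n},\quad I(j)!=a_1!\cdots a_n!,$$ where $I(j)=(a_1,\dots,a_n)$; here $a_1\ge1$. For example $p_3=-x_1$, $p_4=\tfrac12x_1^2$, $p_5=x_1x_2$. The constant $c_j$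 is the nonzero constant determined by $\frac{\partial}{\partial x_1}(c_jx_1p_j)=-p_j$, that is, $c_j=-1/(a_1+1)$ where $a_1$ is the exponent of $x_1$ in $p_j$. *)

theory Defs
  imports "HOL-Analysis.Analysis"
begin

definition lie_bracket :: "('a::real_vector \<Rightarrow> 'a \<Rightarrow> 'a) \<Rightarrow> bool" where
  "lie_bracket br \<longleftrightarrow> bilinear br \<and> (\<forall>x. br x x = 0) \<and>
     (\<forall>x y z. br x (br y z) + br y (br z x) + br z (br x y) = 0)"

text \<open>The free real Lie algebra on two generators is the algebra of terms in the operations of a
  real Lie algebra, modulo the equations derivable from the Lie algebra axioms.\<close>

datatype lie_term = TGen1 | TGen2 | TZero | TAdd lie_term lie_term
  | TScale real lie_term | TBracket lie_term lie_term

inductive lie_eq :: "lie_term \<Rightarrow> lie_term \<Rightarrow> bool" where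
  refl: "lie_eq t t"
| sym: "lie_eq t u \<Longrightarrow> lie_eq u t"
| trans: "lie_eq t u \<Longrightarrow> lie_eq u v \<Longrightarrow> lie_eq t v"
| cong_add: "lie_eq t t' \<Longrightarrow> lie_eq u u' \<Longrightarrow> lie_eq (TAdd t u) (TAdd t' u')"
| cong_scale: "lie_eq t t' \<Longrightarrow> lie_eq (TScale c t) (TScale c t')"
| cong_bracket: "lie_eq t t' \<Longrightarrow> lie_eq u u' \<Longrightarrow> lie_eq (TBracket t u) (TBracket t' u')"
| add_assoc: "lie_eq (TAdd (TAdd t u) v) (TAdd t (TAdd u v))"
| add_commute: "lie_eq (TAdd t u) (TAdd u t)"
| add_zero: "lie_eq (TAdd TZero t) t"
| add_inverse: "lie_eq (TAdd (TScale (- 1) t) t) TZero"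
| scale_add: "lie_eq (TScale c (TAdd t u)) (TAdd (TScale c t) (TScale c u))"
| add_scale: "lie_eq (TScale (c + d) t) (TAdd (TScale c t) (TScale d t))"
| scale_scale: "lie_eq (TScale c (TScale d t)) (TScale (c * d) t)"
| scale_one: "lie_eq (TScale 1 t) t"
| bracket_add_left: "lie_eq (TBracket (TAdd t u) v) (TAdd (TBracket t v) (TBracket u v))"
| bracket_add_right: "lie_eq (TBracket t (TAdd u v)) (TAdd (TBracket t u) (TBracket t v))"
| bracket_scale_left: "lie_eq (TBracket (TScale c t) u) (TScale c (TBracket t u))"
| bracket_scale_right: "lie_eq (TBracket t (TScale c u)) (TScale c (TBracket t u))"
| bracket_self: "lie_eq (TBracket t t) TZero"
| jacobi: "lie_eq (TAdd (TAdd (TBracket t (TBracket u v)) (TBracket u (TBracket v t)))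
                    (TBracket v (TBracket t u))) TZero"

quotient_type free_lie2 = lie_term / lie_eq
  by (intro equivpI reflpI sympI transpI) (auto intro: lie_eq.refl lie_eq.sym lie_eq.trans)

instantiation free_lie2 :: real_vector
begin

lift_definition zero_free_lie2 :: free_lie2 is TZero .

lift_definition plus_free_lie2 :: "free_lie2 \<Rightarrow> free_lie2 \<Rightarrow> free_lie2" is TAdd
  by (rule lie_eq.cong_add)

lift_definition scaleR_free_lie2 :: "real \<Rightarrow> free_lie2 \<Rightarrow> free_lie2" is TScale
  by (rule lie_eq.cong_scale)

definition uminus_free_lie2 :: "free_lie2 \<Rightarrow> free_lie2" where
  "uminus_free_lie2 u = (- 1) *\<^sub>R u"

definition minus_free_lie2 :: "free_lie2 \<Rightarrow> free_lie2 \<Rightarrow> free_lie2" where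
  "minus_free_lie2 u v = u + - v"

instance
proof
  fix a b c :: free_lie2 and x y :: real
  show "a + b + c = a + (b + c)" by transfer (rule lie_eq.add_assoc)
  show "a + b = b + a" by transfer (rule lie_eq.add_commute)
  show "0 + a = a" by transfer (rule lie_eq.add_zero)
  show "- a + a = 0" unfolding uminus_free_lie2_def by transfer (rule lie_eq.add_inverse)
  show "a - b = a + - b" by (rule minus_free_lie2_def)
  show "x *\<^sub>R (a + b) = x *\<^sub>R a + x *\<^sub>R b" by transfer (rule lie_eq.scale_add)
  show "(x + y) *\<^sub>R a = x *\<^sub>R a + y *\<^sub>R a" by transfer (rule lie_eq.add_scale)
  show "x *\<^sub>R y *\<^sub>R a = (x * y) *\<^sub>R a" by transfer (rule lie_eq.scale_scale)
  show "1 *\<^sub>R a = a" by transfer (rule lie_eq.scale_one)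
qed

end

lift_definition free_gen1 :: free_lie2 is TGen1 .
lift_definition free_gen2 :: free_lie2 is TGen2 .

lift_definition free_bracket :: "free_lie2 \<Rightarrow> free_lie2 \<Rightarrow> free_lie2" is TBracket
  by (rule lie_eq.cong_bracket)

lemma lie_bracket_free_bracket: "lie_bracket free_bracket"
  unfolding lie_bracket_def bilinear_def
proof (intro conjI allI linearI)
  fix x y z :: free_lie2 and c :: real
  show "free_bracket x (y + z) = free_bracket x y + free_bracket x z"
    by transfer (rule lie_eq.bracket_add_right)
  show "free_bracket x (c *\<^sub>R y) = c *\<^sub>R free_bracket x y"
    by transfer (rule lie_eq.bracket_scale_right)
  show "free_bracket (x + y) z = free_bracket x z + free_bracket y z"
    by transfer (rule lie_eq.bracket_add_left)
  show "free_bracket (c *\<^sub>R x) y = c *\<^sub>R free_bracket x y"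
    by transfer (rule lie_eq.bracket_scale_left)
  show "free_bracket x x = 0"
    by transfer (rule lie_eq.bracket_self)
  show "free_bracket x (free_bracket y z) + free_bracket y (free_bracket z x)
      + free_bracket z (free_bracket x y) = 0"
    by transfer (rule lie_eq.jacobi)
qed

definition lie_hom :: "('a::real_vector \<Rightarrow> 'a \<Rightarrow> 'a) \<Rightarrow> ('b::real_vector \<Rightarrow> 'b \<Rightarrow> 'b) \<Rightarrow> ('a \<Rightarrow> 'b) \<Rightarrow> bool"
  where "lie_hom br br' \<phi> \<longleftrightarrow> linear \<phi> \<and> (\<forall>u v. \<phi> (br u v) = br' (\<phi> u) (\<phi> v))"

primrec lie_eval :: "('b::real_vector \<Rightarrow> 'b \<Rightarrow> 'b) \<Rightarrow> 'b \<Rightarrow> 'b \<Rightarrow> lie_term \<Rightarrow> 'b" where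
  "lie_eval br y1 y2 TGen1 = y1"
| "lie_eval br y1 y2 TGen2 = y2"
| "lie_eval br y1 y2 TZero = 0"
| "lie_eval br y1 y2 (TAdd t u) = lie_eval br y1 y2 t + lie_eval br y1 y2 u"
| "lie_eval br y1 y2 (TScale c t) = c *\<^sub>R lie_eval br y1 y2 t"
| "lie_eval br y1 y2 (TBracket t u) = br (lie_eval br y1 y2 t) (lie_eval br y1 y2 u)"

lemma lie_eval_respects:
  assumes "lie_bracket br" and "lie_eq t u"
  shows "lie_eval br y1 y2 t = lie_eval br y1 y2 u"
  using assms(2)
proof induction
qed (use assms(1) in \<open>simp_all add: lie_bracket_def algebra_simps
        bilinear_ladd bilinear_radd bilinear_lmul bilinear_rmul\<close>)

theorem free_lie2_universal:
  assumes br: "lie_bracket br"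
  shows "\<exists>!\<phi>. lie_hom free_bracket br \<phi> \<and> \<phi> free_gen1 = y1 \<and> \<phi> free_gen2 = y2"
proof (rule ex1I)
  define \<phi> where "\<phi> u = lie_eval br y1 y2 (rep_free_lie2 u)" for u
  have abs: "\<phi> (abs_free_lie2 t) = lie_eval br y1 y2 t" for t
  proof -
    have "lie_eq (rep_free_lie2 (abs_free_lie2 t)) t"
      using Quotient3_free_lie2 by (metis Quotient3_def lie_eq.refl)
    then show ?thesis unfolding \<phi>_def by (rule lie_eval_respects[OF br])
  qed
  have ex: "\<exists>t. u = abs_free_lie2 t" for u
    using Quotient3_free_lie2 by (metis Quotient3_abs_rep)
  show hom: "lie_hom free_bracket br \<phi> \<and> \<phi> free_gen1 = y1 \<and> \<phi> free_gen2 = y2"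
    unfolding lie_hom_def
  proof (intro conjI allI linearI)
    fix u v :: free_lie2 and c :: real
    obtain t t' where [simp]: "u = abs_free_lie2 t" "v = abs_free_lie2 t'" using ex by blast
    show "\<phi> (u + v) = \<phi> u + \<phi> v" by (simp add: plus_free_lie2.abs_eq abs)
    show "\<phi> (c *\<^sub>R u) = c *\<^sub>R \<phi> u" by (simp add: scaleR_free_lie2.abs_eq abs)
    show "\<phi> (free_bracket u v) = br (\<phi> u) (\<phi> v)" by (simp add: free_bracket.abs_eq abs)
  qed (simp_all add: free_gen1_def free_gen2_def abs)
  fix \<psi> assume \<psi>: "lie_hom free_bracket br \<psi> \<and> \<psi> free_gen1 = y1 \<and> \<psi> free_gen2 = y2"
  then have lin: "linear \<psi>" by (simp add: lie_hom_def)
  have "\<psi> (abs_free_lie2 t) = lie_eval br y1 y2 t" for t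
  proof (induction t)
    case TGen1 then show ?case using \<psi> by (simp add: free_gen1_def)
  next
    case TGen2 then show ?case using \<psi> by (simp add: free_gen2_def)
  next
    case TZero then show ?case using linear_0[OF lin] by (simp add: zero_free_lie2_def)
  next
    case (TAdd t u) then show ?case
      using linear_add[OF lin] by (simp add: plus_free_lie2.abs_eq[symmetric])
  next
    case (TScale c t) then show ?case
      using linear_scale[OF lin] by (simp add: scaleR_free_lie2.abs_eq[symmetric])
  next
    case (TBracket t u) then show ?case
      using \<psi> by (simp add: lie_hom_def free_bracket.abs_eq[symmetric])
  qed
  then show "\<psi> = \<phi>" using abs ex by (metis ext)
qed

text \<open>Lower central series: \<open>lower_central br k\<close> is the \<open>(k + 1)\<close>-st term, starting from the
  whole algebra.\<close>

primrec lower_central :: "('a::real_vector \<Rightarrow> 'a \<Rightarrow> 'a) \<Rightarrow> nat \<Rightarrow> 'a set" where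
  "lower_central br 0 = UNIV"
| "lower_central br (Suc k) = span {br u v | u v. v \<in> lower_central br k}"

text \<open>A Lie algebra is (a copy of) the free nilpotent Lie algebra of step \<open>s\<close> on two generators if
  it is the quotient of the free Lie algebra by the \<open>(s + 1)\<close>-st term of its lower central
  series, i.e. the image of a homomorphism with that kernel.\<close>

definition free_nilpotent2 :: "nat \<Rightarrow> ('a::real_vector \<Rightarrow> 'a \<Rightarrow> 'a) \<Rightarrow> bool" where
  "free_nilpotent2 s br \<longleftrightarrow>
     (\<exists>\<pi>. lie_hom free_bracket br \<pi> \<and> surj \<pi> \<and> {u. \<pi> u = 0} = lower_central free_bracket s)"


text \<open>Whether \<open>[X, Y]\<close> is a basis element depends on the shape of \<open>X\<close> as an iterated bracket, so
  basis elements are formal brackets of the two generators. The order \<open>lt\<close> in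
  \<open>hall_element\<close> is only relevant on the basis elements themselves.\<close>

datatype hall_expr = Gen1 | Gen2 | Bracket hall_expr hall_expr

primrec hall_length :: "hall_expr \<Rightarrow> nat" where
  "hall_length Gen1 = 1"
| "hall_length Gen2 = 1"
| "hall_length (Bracket X Y) = hall_length X + hall_length Y"

inductive hall_element :: "nat \<Rightarrow> (hall_expr \<Rightarrow> hall_expr \<Rightarrow> bool) \<Rightarrow> hall_expr \<Rightarrow> bool"
  for s :: nat and lt :: "hall_expr \<Rightarrow> hall_expr \<Rightarrow> bool" where
  gen1: "hall_element s lt Gen1"
| gen2: "hall_element s lt Gen2"
| bracket: "hall_element s lt X \<Longrightarrow> hall_element s lt Y \<Longrightarrow> lt Y X \<Longrightarrow>
    (\<And>Z W. X = Bracket Z W \<Longrightarrow> W = Y \<or> lt W Y) \<Longrightarrow>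
    hall_length X + hall_length Y \<le> s \<Longrightarrow> hall_element s lt (Bracket X Y)"

definition hall_order :: "nat \<Rightarrow> (hall_expr \<Rightarrow> hall_expr \<Rightarrow> bool) \<Rightarrow> bool" where
  "hall_order s lt \<longleftrightarrow> (let H = Collect (hall_element s lt) in
     (\<forall>X\<in>H. \<not> lt X X) \<and>
     (\<forall>X\<in>H. \<forall>Y\<in>H. \<forall>Z\<in>H. lt X Y \<longrightarrow> lt Y Z \<longrightarrow> lt X Z) \<and>
     (\<forall>X\<in>H. \<forall>Y\<in>H. X \<noteq> Y \<longrightarrow> lt X Y \<or> lt Y X) \<and>
     (\<forall>X\<in>H. \<forall>Y\<in>H. hall_length X < hall_length Y \<longrightarrow> lt X Y) \<and>
     lt Gen1 Gen2)"

text \<open>Increasing numbering \<open>X 1, \<dots>, X n\<close> of the Hall basis. The order, and hence the numbering,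
  is prescribed up to length four and arbitrary among the elements of each larger length.\<close>

definition hall_basis :: "nat \<Rightarrow> nat \<Rightarrow> (nat \<Rightarrow> hall_expr) \<Rightarrow> bool" where
  "hall_basis s n X \<longleftrightarrow> (\<exists>lt. hall_order s lt \<and>
     bij_betw X {1..n} (Collect (hall_element s lt)) \<and>
     (\<forall>i\<in>{1..n}. \<forall>j\<in>{1..n}. i < j \<longrightarrow> lt (X i) (X j)) \<and>
     (3 \<le> s \<longrightarrow> X 4 = Bracket (X 3) (X 1) \<and> X 5 = Bracket (X 3) (X 2)) \<and>
     (4 \<le> s \<longrightarrow> X 6 = Bracket (X 4) (X 1) \<and> X 7 = Bracket (X 4) (X 2) \<and> X 8 = Bracket (X 5) (X 2)))"


text \<open>The right entries met while repeatedly expanding the left entry of the bracket: the entries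
  \<open>X\<^sub>i\<^sub>1, \<dots>, X\<^sub>i\<^sub>m\<close> in this order. For a Hall element of length at least two, the remaining
  leftmost entry is \<open>X 2\<close>.\<close>

primrec right_entries :: "hall_expr \<Rightarrow> hall_expr list" where
  "right_entries Gen1 = []"
| "right_entries Gen2 = []"
| "right_entries (Bracket X Y) = right_entries X @ [Y]"

definition hall_depth :: "(nat \<Rightarrow> hall_expr) \<Rightarrow> nat \<Rightarrow> nat" where
  "hall_depth X i = length (right_entries (X i))"

text \<open>\<open>hall_exponent X i r\<close> is the component \<open>a\<^sub>r\<close> of the multi-index \<open>I(i)\<close>.\<close>

definition hall_exponent :: "(nat \<Rightarrow> hall_expr) \<Rightarrow> nat \<Rightarrow> nat \<Rightarrow> nat" where
  "hall_exponent X i r = count_list (right_entries (X i)) (X r)"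

text \<open>Points of \<open>n\<close>-space are functions \<open>x\<close> on the natural numbers, of which only the coordinates
  \<open>x 1, \<dots>, x n\<close> are used.\<close>

definition hall_monomial :: "nat \<Rightarrow> (nat \<Rightarrow> hall_expr) \<Rightarrow> nat \<Rightarrow> (nat \<Rightarrow> real) \<Rightarrow> real" where
  "hall_monomial n X j x =
     (- 1) ^ hall_depth X j / (\<Prod>r=1..n. fact (hall_exponent X j r)) *
     (\<Prod>r=1..n. x r ^ hall_exponent X j r)"

definition partial_deriv :: "nat \<Rightarrow> ((nat \<Rightarrow> real) \<Rightarrow> real) \<Rightarrow> (nat \<Rightarrow> real) \<Rightarrow> real" where
  "partial_deriv k f x = deriv (\<lambda>t. f (x(k := t))) (x k)"

definition hall_const :: "(nat \<Rightarrow> hall_expr) \<Rightarrow> nat \<Rightarrow> real" where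
  "hall_const X j = - 1 / (real (hall_exponent X j 1) + 1)"

lemma hall_const_eq:
  assumes "1 \<le> n"
  shows "partial_deriv 1 (\<lambda>x. hall_const X j * x 1 * hall_monomial n X j x) x
    = - hall_monomial n X j x"
proof -
  define a where "a = hall_exponent X j 1"
  define K where "K = (- 1) ^ hall_depth X j / (\<Prod>r=1..n. fact (hall_exponent X j r) :: real) *
     (\<Prod>r\<in>{1..n} - {1}. x r ^ hall_exponent X j r)"
  have upd: "hall_monomial n X j (x(1 := t)) = K * t ^ a" for t
  proof -
    have "(\<Prod>r=1..n. (x(1 := t)) r ^ hall_exponent X j r) =
        t ^ a * (\<Prod>r\<in>{1..n} - {1}. (x(1 := t)) r ^ hall_exponent X j r)"
      using assms by (subst prod.remove[of _ 1]) (auto simp: a_def)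
    also have "(\<Prod>r\<in>{1..n} - {1}. (x(1 := t)) r ^ hall_exponent X j r) =
        (\<Prod>r\<in>{1..n} - {1}. x r ^ hall_exponent X j r)"
      by (rule prod.cong) auto
    finally show ?thesis by (simp add: hall_monomial_def K_def)
  qed
  have here: "hall_monomial n X j x = K * x 1 ^ a" using upd[of "x 1"] by simp
  have c: "hall_const X j * (real a + 1) = - 1" by (simp add: hall_const_def a_def field_simps)
  have "((\<lambda>t. hall_const X j * K * t ^ Suc a) has_field_derivative
      hall_const X j * K * (real (Suc a) * x 1 ^ a)) (at (x 1))"
    using DERIV_cmult[OF DERIV_pow[of "Suc a" "x 1"], of "hall_const X j * K"] by simp
  then have "deriv (\<lambda>t. hall_const X j * K * t ^ Suc a) (x 1)
      = (hall_const X j * (real a + 1)) * (K * x 1 ^ a)"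
    by (subst DERIV_imp_deriv) (auto simp: algebra_simps)
  moreover have "(\<lambda>t. hall_const X j * t * (K * t ^ a)) = (\<lambda>t. hall_const X j * K * t ^ Suc a)"
    by (rule ext) simp
  ultimately show ?thesis
    by (simp only: partial_deriv_def upd here c fun_upd_same)
qed


definition solves_eq ::
  "nat \<Rightarrow> (nat \<Rightarrow> hall_expr) \<Rightarrow> nat \<Rightarrow> ((nat \<Rightarrow> real) \<Rightarrow> real) \<Rightarrow> bool" where
  "solves_eq n X j r \<longleftrightarrow> (let p = hall_monomial n X in
     \<forall>x. hall_const X j * x 1 *
           (partial_deriv 2 (p j) x + (\<Sum>k=3..n. p k x * partial_deriv k (p j) x))
         + (\<Sum>l=3..n. p l x * partial_deriv l r x) = 0)"

definition ansatz :: "nat \<Rightarrow> (nat \<Rightarrow> real) \<Rightarrow> (nat \<Rightarrow> real) \<Rightarrow> (nat \<Rightarrow> real) \<Rightarrow> real" where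
  "ansatz n a b x = (\<Sum>k=3..n. a k * x k) + (\<Sum>l=3..n. b l * (x l)\<^sup>2)"

end

theory Submission
  imports Defs
begin

text \<open>Write the index multiset of \<open>X\<^sub>j\<close> for the multiset of indices of its right entries. The term
  \<open>c\<^sub>j x\<^sub>1 p\<^sub>k \<partial>p\<^sub>j/\<partial>x\<^sub>k\<close> (with \<open>p\<^sub>2 = 1\<close>) is a multiple of the monomial whose index multiset arises
  from that of \<open>X\<^sub>j\<close> by exchanging one \<open>k\<close> for a \<open>1\<close> and the index multiset of \<open>X\<^sub>k\<close>; the exchange
  preserves the length. Sorted again, the new multiset is that of a Hall element, hence the
  term is a multiple of some \<open>p\<^sub>l\<close>, unless some entry \<open>X\<^sub>y\<close> of \<open>X\<^sub>j\<close> has the same length as the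
  prefix of \<open>X\<^sub>j\<close> before it and that prefix has \<open>X\<^sub>k\<close> as an entry. Up to length eight this forces
  \<open>X\<^sub>j = [P, X\<^sub>y]\<close> with \<open>P\<close> and \<open>X\<^sub>y\<close> both of length three or both of length four, and then the term
  is a multiple of some \<open>p\<^sub>l\<close> or of some \<open>x\<^sub>l p\<^sub>l\<close>. In length nine, \<open>[[X\<^sub>5, X\<^sub>4], X\<^sub>4]\<close> produces
  \<open>x\<^sub>1\<^sup>2 x\<^sub>4\<^sup>2\<close>, which is neither.\<close>

section \<open>Hall elements as lists of right entries\<close>

text \<open>Every Hall element except \<open>Gen1\<close> has \<open>Gen2\<close> as its leftmost
  entry, so its list of right entries determines it; hence the fixed start
  \<open>Gen2\<close>.\<close>

definition bracket_list :: "hall_expr list \<Rightarrow> hall_expr" where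
  "bracket_list ys = foldl Bracket Gen2 ys"

lemma bracket_list_simps [simp]:
  "bracket_list [] = Gen2"
  "bracket_list (ys @ [y]) = Bracket (bracket_list ys) y"
  by (simp_all add: bracket_list_def)

lemma right_entries_bracket_list [simp]: "right_entries (bracket_list ys) = ys"
  by (induction ys rule: rev_induct) simp_all

lemma hall_length_bracket_list: "hall_length (bracket_list ys) = 1 + sum_list (map hall_length ys)"
  by (induction ys rule: rev_induct) simp_all

lemma hall_length_pos: "1 \<le> hall_length Z"
  by (induction Z) auto

lemma bracket_list_neq_Gen1: "bracket_list ys \<noteq> Gen1"
  by (cases ys rule: rev_cases) simp_all

lemma sorted_split: "sorted ks \<Longrightarrow> ks = filter (\<lambda>i. i < y) ks @ filter (\<lambda>i. y \<le> i) ks"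
  for y :: "'a::linorder"
proof (induction ks)
  case (Cons a ks)
  then show ?case
  proof (cases "a < y")
    case False
    then have "filter (\<lambda>i. i < y) ks = []" "filter (\<lambda>i. y \<le> i) ks = ks"
      using Cons.prems by (auto simp: filter_empty_conv filter_id_conv)
    then show ?thesis using False by simp
  qed auto
qed simp

text \<open>Unpacks \<open>hall_basis\<close> for one fixed witness \<open>lt\<close> of its
  existential quantifier.\<close>

locale hall_numbering =
  fixes s n :: nat and X :: "nat \<Rightarrow> hall_expr" and lt :: "hall_expr \<Rightarrow> hall_expr \<Rightarrow> bool"
  assumes two_le_s: "2 \<le> s"
    and order: "hall_order s lt"
    and bij: "bij_betw X {1..n} (Collect (hall_element s lt))"
    and lt_X: "\<And>i j. i \<in> {1..n} \<Longrightarrow> j \<in> {1..n} \<Longrightarrow> i < j \<Longrightarrow> lt (X i) (X j)"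
    and X45: "3 \<le> s \<Longrightarrow> X 4 = Bracket (X 3) (X 1) \<and> X 5 = Bracket (X 3) (X 2)"
    and X678: "4 \<le> s \<Longrightarrow> X 6 = Bracket (X 4) (X 1) \<and> X 7 = Bracket (X 4) (X 2) \<and> X 8 = Bracket (X 5) (X 2)"
begin

abbreviation hall :: "hall_expr \<Rightarrow> bool" where "hall \<equiv> hall_element s lt"

lemma lt_irrefl: "hall Z \<Longrightarrow> \<not> lt Z Z"
  and lt_trans: "hall Y \<Longrightarrow> hall Z \<Longrightarrow> hall W \<Longrightarrow> lt Y Z \<Longrightarrow> lt Z W \<Longrightarrow> lt Y W"
  and lt_length: "hall Y \<Longrightarrow> hall Z \<Longrightarrow> hall_length Y < hall_length Z \<Longrightarrow> lt Y Z"
  and lt_gens: "lt Gen1 Gen2"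
  using order unfolding hall_order_def Let_def Ball_def mem_Collect_eq by metis+

lemma lt_asym: "hall Y \<Longrightarrow> hall Z \<Longrightarrow> lt Y Z \<Longrightarrow> \<not> lt Z Y"
  using lt_irrefl lt_trans by blast

lemma length_le: "hall Y \<Longrightarrow> hall Z \<Longrightarrow> lt Y Z \<Longrightarrow> hall_length Y \<le> hall_length Z"
  using lt_length lt_asym by (meson not_le)

lemma hall_X: "i \<in> {1..n} \<Longrightarrow> hall (X i)"
  using bij by (auto simp: bij_betw_def)

lemma hall_is_X: "hall Z \<Longrightarrow> \<exists>i\<in>{1..n}. Z = X i"
  using bij by (auto simp: bij_betw_def)

lemma inj_X: "inj_on X {1..n}"
  using bij by (auto simp: bij_betw_def)

lemma lt_X_iff: "i \<in> {1..n} \<Longrightarrow> j \<in> {1..n} \<Longrightarrow> lt (X i) (X j) \<longleftrightarrow> i < j"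
  by (metis hall_X lt_X lt_asym lt_irrefl linorder_neqE_nat)

lemma hall_length_eq_1: "hall_length Z = 1 \<longleftrightarrow> Z = Gen1 \<or> Z = Gen2"
proof (cases Z)
  case (Bracket A B)
  then show ?thesis using hall_length_pos[of A] hall_length_pos[of B] by auto
qed auto

lemma lt_Gen1: "hall Z \<Longrightarrow> Z \<noteq> Gen1 \<Longrightarrow> lt Gen1 Z"
  by (metis lt_gens hall_element.gen1 hall_length.simps(1) hall_length_eq_1 hall_length_pos
      le_neq_implies_less lt_length)

lemma lt_Gen2: "hall Z \<Longrightarrow> Z \<noteq> Gen1 \<Longrightarrow> Z \<noteq> Gen2 \<Longrightarrow> lt Gen2 Z"
  by (metis hall_element.gen2 hall_length.simps(2) hall_length_eq_1 hall_length_pos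
      le_neq_implies_less lt_length)

lemma hall_Bracket_iff:
  "hall (Bracket Y Z) \<longleftrightarrow> hall Y \<and> hall Z \<and> lt Z Y \<and>
     (\<forall>U W. Y = Bracket U W \<longrightarrow> W = Z \<or> lt W Z) \<and> hall_length Y + hall_length Z \<le> s"
  by (subst hall_element.simps) auto

text \<open>Since \<open>Gen1\<close> is the least Hall element, no right entry can be smaller than
  it.\<close>

lemma hall_Bracket_not_Gen1: "hall (Bracket Y Z) \<Longrightarrow> Y \<noteq> Gen1"
  by (metis hall_Bracket_iff lt_Gen1 lt_asym lt_irrefl)

lemma bracket_list_right_entries: "hall Z \<Longrightarrow> Z \<noteq> Gen1 \<Longrightarrow> bracket_list (right_entries Z) = Z"
proof (induction Z rule: hall_element.induct)
  case (bracket Y Z)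
  then have "hall (Bracket Y Z)" by (intro hall_element.bracket) auto
  then show ?case using bracket hall_Bracket_not_Gen1 by auto
qed simp_all

definition bracket_ind :: "nat list \<Rightarrow> hall_expr" where
  "bracket_ind ks = bracket_list (map X ks)"

abbreviation len :: "nat \<Rightarrow> nat" where "len i \<equiv> hall_length (X i)"

lemma bracket_ind_simps [simp]:
  "bracket_ind [] = Gen2"
  "bracket_ind [i] = Bracket Gen2 (X i)"
  "bracket_ind (ks @ [i]) = Bracket (bracket_ind ks) (X i)"
  using bracket_list_simps(2)[of "[]"] by (simp_all add: bracket_ind_def)

lemma hall_length_bracket_ind: "hall_length (bracket_ind ks) = 1 + sum_list (map len ks)"
  by (simp add: bracket_ind_def hall_length_bracket_list comp_def)

lemma bracket_ind_neq_Gen1: "bracket_ind ks \<noteq> Gen1"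
  by (simp add: bracket_ind_def bracket_list_neq_Gen1)

text \<open>The second Hall condition looks only at the outermost right entry of the left factor,
  which is the last index; for the empty list the left factor \<open>Gen2\<close> has none.\<close>

lemma hall_bracket_ind_snoc:
  assumes "i \<in> {1..n}" "set ks \<subseteq> {1..n}"
  shows "hall (bracket_ind (ks @ [i])) \<longleftrightarrow> hall (bracket_ind ks) \<and> lt (X i) (bracket_ind ks) \<and>
     (ks \<noteq> [] \<longrightarrow> last ks \<le> i) \<and> 1 + sum_list (map len ks) + len i \<le> s"
proof (cases ks rule: rev_cases)
  case Nil
  then show ?thesis using assms by (auto simp: hall_Bracket_iff hall_X)
next
  case (snoc js j)
  then have j: "j \<in> {1..n}" using assms by auto
  have "X j = X i \<or> lt (X j) (X i) \<longleftrightarrow> j \<le> i"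
    using j assms(1) by (metis lt_X_iff inj_onD inj_X le_eq_less_or_eq)
  moreover have "bracket_ind ks = Bracket (bracket_ind js) (X j)" using snoc by simp
  ultimately have "(\<forall>U W. bracket_ind ks = Bracket U W \<longrightarrow> W = X i \<or> lt W (X i)) \<longleftrightarrow> j \<le> i"
    by auto
  moreover have "ks \<noteq> []" "last ks = j" using snoc by simp_all
  ultimately show ?thesis
    using hall_X[OF assms(1)] hall_Bracket_iff[of "bracket_ind ks" "X i"]
    by (simp add: hall_length_bracket_ind)
qed

lemma hall_bracket_ind_append:
  "hall (bracket_ind (us @ vs)) \<Longrightarrow> hall (bracket_ind us)"
  by (induction vs rule: rev_induct) (auto simp: hall_Bracket_iff simp flip: append_assoc)

lemma sorted_if_hall:
  "hall (bracket_ind ks) \<Longrightarrow> set ks \<subseteq> {1..n} \<Longrightarrow> sorted ks"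
proof (induction ks rule: rev_induct)
  case (snoc i ks)
  then have h: "hall (bracket_ind ks)" and s: "sorted ks" and l: "ks \<noteq> [] \<longrightarrow> last ks \<le> i"
    using hall_bracket_ind_snoc[of i ks] by auto
  have "x \<le> i" if "x \<in> set ks" for x
  proof -
    have "x \<le> last ks" using that s
      by (cases ks rule: rev_cases) (auto simp: sorted_append)
    then show ?thesis using l that by auto
  qed
  then show ?case using s by (auto simp: sorted_append)
qed simp

text \<open>The list is sorted, so the entries below \<open>y\<close> form a prefix and the first
  \<open>y\<close> follows it directly. Prefixes of Hall lists are Hall, also the one ending with
  this \<open>y\<close>.\<close>

lemma hall_split:
  assumes "hall (bracket_ind ks)" "set ks \<subseteq> {1..n}" "y \<in> set ks"
  obtains us vs where "us = filter (\<lambda>i. i < y) ks" "ks = us @ y # vs"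
    "\<forall>v\<in>set vs. y \<le> v" "hall (bracket_ind us)" "lt (X y) (bracket_ind us)"
proof -
  define us ws where "us = filter (\<lambda>i. i < y) ks" and "ws = filter (\<lambda>i. y \<le> i) ks"
  have "sorted ks" using assms sorted_if_hall by blast
  then have spl: "ks = us @ ws" unfolding us_def ws_def by (rule sorted_split)
  have sw: "sorted ws" using \<open>sorted ks\<close> by (simp add: ws_def sorted_wrt_filter)
  have y: "y \<in> set ws" using assms(3) by (simp add: ws_def)
  then obtain w vs where w: "ws = w # vs" by (cases ws) auto
  then have "w \<le> y" using y sw by auto
  moreover have "\<forall>z\<in>set ws. y \<le> z" by (auto simp: ws_def)
  ultimately have ws: "ws = y # vs" using w by simp
  have h: "hall (bracket_ind (us @ [y]))"
    using hall_bracket_ind_append[of "us @ [y]" vs] assms(1) spl ws by simp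
  then have "hall (bracket_ind us)" "lt (X y) (bracket_ind us)"
    by (auto simp: hall_Bracket_iff)
  moreover have "ks = us @ y # vs" using spl ws by simp
  moreover have "\<forall>v\<in>set vs. y \<le> v" using ws sw by simp
  ultimately show thesis using that us_def by blast
qed

text \<open>The order among elements of equal length is not known in general, so an entry is
  compared with the prefix before it by a strict inequality of lengths, which suffices. Entries
  equal to 1 are exempt because \<open>Gen1\<close> is least. Testing the entries strictly below
  \<open>y\<close> also covers repeated copies of \<open>y\<close>, whose prefixes are only
  longer.\<close>

lemma hall_bracket_indI:
  assumes "sorted ks" "set ks \<subseteq> {1..n}" "ks \<noteq> [] \<Longrightarrow> hd ks = 1" "1 + sum_list (map len ks) \<le> s"
    and "\<And>y. y \<in> set ks \<Longrightarrow> y \<noteq> 1 \<Longrightarrow> len y < 1 + sum_list (map len (filter (\<lambda>i. i < y) ks))"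
    and X1: "X 1 = Gen1"
  shows "hall (bracket_ind ks)"
  using assms(1-5)
proof (induction ks rule: rev_induct)
  case Nil
  then show ?case by (simp add: hall_element.gen2)
next
  case (snoc i ks)
  have sle: "\<forall>x\<in>set ks. x \<le> i" "sorted ks" using snoc.prems(1) by (auto simp: sorted_append)
  have h: "hall (bracket_ind ks)"
  proof (rule snoc.IH)
    show "hd ks = 1" if "ks \<noteq> []" using snoc.prems(3) that by simp
    show "len y < 1 + sum_list (map len (filter (\<lambda>i. i < y) ks))" if "y \<in> set ks" "y \<noteq> 1" for y
    proof -
      \<comment> \<open>Appending the maximal index \<open>i\<close> does not change the part of the
        list below \<open>y\<close>.\<close>
      have "\<not> i < y" using sle that by auto
      then show ?thesis using snoc.prems(5)[of y] that by simp
    qed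
  qed (use snoc.prems sle in auto)
  have "lt (X i) (bracket_ind ks)"
  proof (cases "i = 1")
    case True
    then show ?thesis using X1 lt_Gen1 h bracket_ind_neq_Gen1 by simp
  next
    case False
    have "len i < 1 + sum_list (map len (filter (\<lambda>j. j < i) (ks @ [i])))"
      using snoc.prems(5)[of i] False by simp
    also have "\<dots> \<le> 1 + sum_list (map len ks)"
      by (simp) (simp add: sum_list_filter_le_nat)
    finally show ?thesis
      using h snoc.prems(2) by (intro lt_length) (auto simp: hall_X hall_length_bracket_ind)
  qed
  moreover have "ks \<noteq> [] \<longrightarrow> last ks \<le> i" using sle by simp
  ultimately show ?case using snoc.prems h by (subst hall_bracket_ind_snoc) auto
qed

section \<open>Hall elements of length at most four and the first indices\<close>

lemma hall_Gen: "hall Gen1" "hall Gen2" "hall (Bracket Gen2 Gen1)"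
  using two_le_s by (auto simp: hall_Bracket_iff hall_element.gen1 hall_element.gen2 lt_gens)

lemma hall_length_2: "hall Z \<Longrightarrow> hall_length Z = 2 \<Longrightarrow> Z = Bracket Gen2 Gen1"
proof (cases Z)
  case (Bracket A B)
  assume Z: "hall Z" "hall_length Z = 2"
  have "hall_length A = 1" "hall_length B = 1"
    using Z hall_length_pos[of A] hall_length_pos[of B] Bracket by auto
  then show ?thesis using Z Bracket hall_length_eq_1 lt_irrefl
    by (metis hall_Bracket_iff hall_Bracket_not_Gen1)
qed auto

text \<open>Explicit lists of Hall elements thus bound \<open>n\<close> from below, which puts the
  small indices in range.\<close>

lemma length_le_n:
  assumes "distinct Zs" "list_all hall Zs"
  shows "length Zs \<le> n"
proof -
  have "set Zs \<subseteq> X ` {1..n}" using assms(2) bij by (auto simp: list_all_iff bij_betw_def)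
  then have "card (set Zs) \<le> card (X ` {1..n})" by (intro card_mono) auto
  also have "\<dots> \<le> n" by (metis card_image_le card_atLeastAtMost diff_Suc_1 finite_atLeastAtMost)
  finally show ?thesis using distinct_card[OF assms(1)] by simp
qed

lemma n_ge_3: "3 \<le> n"
  using length_le_n[of "[Gen1, Gen2, Bracket Gen2 Gen1]"] hall_Gen by auto

text \<open>The first three numbers are not prescribed by \<open>hall_basis\<close>. They follow
  from the order: \<open>Gen1\<close> is least, \<open>Gen2\<close> comes next, and only one Hall
  element has length two.\<close>

lemma X1: "X 1 = Gen1"
proof -
  obtain i where i: "i \<in> {1..n}" "Gen1 = X i" using hall_is_X hall_Gen by blast
  then have "\<not> 1 < i" 
    using lt_X[of 1 i] lt_Gen1[of "X 1"] hall_X[of 1] n_ge_3 lt_asym hall_Gen(1) lt_irrefl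
    by (metis atLeastAtMost_iff le_refl order_trans)
  then show ?thesis using i by (cases "i = 1") auto
qed

lemma X2: "X 2 = Gen2"
proof -
  obtain i where i: "i \<in> {1..n}" "Gen2 = X i" using hall_is_X hall_Gen by blast
  have 2: "2 \<in> {1..n}" "1 \<in> {1..n}" using n_ge_3 by auto
  have "X 2 \<noteq> Gen1" using X1 inj_onD[OF inj_X _ 2] by force
  then have "X 2 = Gen2 \<or> lt Gen2 (X 2)" using lt_Gen2 hall_X 2 by blast
  then have "i \<le> 2" using i lt_X_iff[of i 2] inj_onD[OF inj_X, of i 2] 2 by auto
  moreover have "i \<noteq> 1" using i X1 by auto
  ultimately show ?thesis using i by (cases "i = 2") auto
qed

lemma len_ge_2: "3 \<le> i \<Longrightarrow> i \<le> n \<Longrightarrow> 2 \<le> len i"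
  using inj_onD[OF inj_X, of i 1] inj_onD[OF inj_X, of i 2] X1 X2 n_ge_3
    hall_length_eq_1[of "X i"] hall_length_pos[of "X i"] by auto

lemma X3: "X 3 = Bracket Gen2 Gen1"
proof -
  obtain i where i: "i \<in> {1..n}" "Bracket Gen2 Gen1 = X i" using hall_is_X hall_Gen by blast
  have 3: "3 \<in> {1..n}" "2 \<in> {1..n}" using n_ge_3 by auto
  have "X 3 = X i \<or> lt (X i) (X 3)"
    using hall_length_2[of "X 3"] lt_length[of "X i" "X 3"] len_ge_2[of 3] i 3 hall_X
    by (metis Suc_1 atLeastAtMost_iff hall_length.simps le_neq_implies_less le_refl plus_1_eq_Suc)
  then have "i \<le> 3" using i lt_X_iff[of i 3] inj_onD[OF inj_X, of i 3] 3 by auto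
  moreover have "i \<noteq> 1" "i \<noteq> 2" using i X1 X2 by auto
  ultimately show ?thesis using i by (cases "i = 3") auto
qed

lemma X4: "3 \<le> s \<Longrightarrow> X 4 = Bracket (Bracket Gen2 Gen1) Gen1"
  and X5: "3 \<le> s \<Longrightarrow> X 5 = Bracket (Bracket Gen2 Gen1) Gen2"
  using X45 X1 X2 X3 by auto

lemma X6: "4 \<le> s \<Longrightarrow> X 6 = Bracket (Bracket (Bracket Gen2 Gen1) Gen1) Gen1"
  and X7: "4 \<le> s \<Longrightarrow> X 7 = Bracket (Bracket (Bracket Gen2 Gen1) Gen1) Gen2"
  and X8: "4 \<le> s \<Longrightarrow> X 8 = Bracket (Bracket (Bracket Gen2 Gen1) Gen2) Gen2"
  using X678 X1 X2 X4 X5 by auto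

lemma hall_3:
  assumes "3 \<le> s"
  shows "hall (Bracket (Bracket Gen2 Gen1) Gen1)" "hall (Bracket (Bracket Gen2 Gen1) Gen2)"
  using assms hall_Gen lt_gens lt_length[OF hall_Gen(1) hall_Gen(3)] lt_length[OF hall_Gen(2) hall_Gen(3)]
  by (auto simp: hall_Bracket_iff[of "Bracket Gen2 Gen1"])

lemma hall_4:
  assumes "4 \<le> s"
  shows "hall (Bracket (Bracket (Bracket Gen2 Gen1) Gen1) Gen1)"
    "hall (Bracket (Bracket (Bracket Gen2 Gen1) Gen1) Gen2)"
    "hall (Bracket (Bracket (Bracket Gen2 Gen1) Gen2) Gen2)"
  using assms hall_Gen lt_gens hall_3 lt_length[OF hall_Gen(1) hall_3(1)] lt_length[OF hall_Gen(2) hall_3(1)]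
     lt_length[OF hall_Gen(2) hall_3(2)]
  by (simp_all add: hall_Bracket_iff[of "Bracket (Bracket _ _) _"])

lemma n_ge_5: "3 \<le> s \<Longrightarrow> 5 \<le> n"
  using length_le_n[of "[Gen1, Gen2, Bracket Gen2 Gen1, Bracket (Bracket Gen2 Gen1) Gen1,
    Bracket (Bracket Gen2 Gen1) Gen2]"] hall_Gen hall_3 by auto

lemma n_ge_8: "4 \<le> s \<Longrightarrow> 8 \<le> n"
  using length_le_n[of "[Gen1, Gen2, Bracket Gen2 Gen1, Bracket (Bracket Gen2 Gen1) Gen1,
    Bracket (Bracket Gen2 Gen1) Gen2, Bracket (Bracket (Bracket Gen2 Gen1) Gen1) Gen1,
    Bracket (Bracket (Bracket Gen2 Gen1) Gen1) Gen2, Bracket (Bracket (Bracket Gen2 Gen1) Gen2) Gen2]"]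
    hall_Gen hall_3 hall_4 by auto

lemma hall_length_3:
  assumes "hall Z" "hall_length Z = 3"
  shows "Z = Bracket (Bracket Gen2 Gen1) Gen1 \<or> Z = Bracket (Bracket Gen2 Gen1) Gen2"
proof (cases Z)
  case (Bracket A B)
  then have AB: "hall A" "hall B" "lt B A" "hall_length A + hall_length B = 3"
    using assms by (auto simp: hall_Bracket_iff)
  then have "hall_length A = 2" "hall_length B = 1"
    using length_le[of B A] hall_length_pos[of B] by auto
  then show ?thesis using hall_length_2 AB hall_length_eq_1 Bracket by blast
qed (use assms in auto)

text \<open>Lengths 2 + 2 would need two different Hall elements of length two. Of the four brackets
  with lengths 3 + 1, the one of \<open>[[Gen2, Gen1], Gen2]\<close> with \<open>Gen1\<close>
  violates the second Hall condition.\<close>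

lemma hall_length_4:
  assumes "hall Z" "hall_length Z = 4"
  shows "Z = Bracket (Bracket (Bracket Gen2 Gen1) Gen1) Gen1 \<or>
    Z = Bracket (Bracket (Bracket Gen2 Gen1) Gen1) Gen2 \<or>
    Z = Bracket (Bracket (Bracket Gen2 Gen1) Gen2) Gen2"
proof (cases Z)
  case (Bracket A B)
  then have AB: "hall A" "hall B" "lt B A" "hall_length A + hall_length B = 4"
    using assms by (auto simp: hall_Bracket_iff)
  have "\<not> (hall_length A = 2 \<and> hall_length B = 2)"
    using hall_length_2[of A] hall_length_2[of B] AB lt_irrefl[of A] by auto
  then have "hall_length A = 3" "hall_length B = 1"
    using AB length_le[of B A] hall_length_pos[of B] by auto
  then have "A = Bracket (Bracket Gen2 Gen1) Gen1 \<or> A = Bracket (Bracket Gen2 Gen1) Gen2"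
    "B = Gen1 \<or> B = Gen2"
    using hall_length_3 AB hall_length_eq_1 by auto
  moreover have "Z \<noteq> Bracket (Bracket (Bracket Gen2 Gen1) Gen2) Gen1"
    using assms(1) lt_gens lt_asym[OF hall_Gen(1,2)] 
    by (auto simp: hall_Bracket_iff[of "Bracket _ Gen2"])
  ultimately show ?thesis using Bracket by auto
qed (use assms in auto)

section \<open>Index lists of the basis elements\<close>

definition entries :: "nat \<Rightarrow> nat list" where
  "entries j = map (inv_into {1..n} X) (right_entries (X j))"

lemma hall_right_entries: "hall Z \<Longrightarrow> W \<in> set (right_entries Z) \<Longrightarrow> hall W"
  by (induction Z rule: hall_element.induct) auto

lemma map_X_entries: "j \<in> {1..n} \<Longrightarrow> map X (entries j) = right_entries (X j)"
  unfolding entries_def map_map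
proof (rule map_idI)
  fix W assume "j \<in> {1..n}" "W \<in> set (right_entries (X j))"
  then have "W \<in> X ` {1..n}" using hall_right_entries hall_X hall_is_X by blast
  then show "(X \<circ> inv_into {1..n} X) W = W" by (simp add: f_inv_into_f)
qed

lemma set_entries: "j \<in> {1..n} \<Longrightarrow> set (entries j) \<subseteq> {1..n}"
proof
  fix i assume "j \<in> {1..n}" "i \<in> set (entries j)"
  then obtain W where "hall W" "i = inv_into {1..n} X W"
    using hall_right_entries hall_X by (auto simp: entries_def)
  then show "i \<in> {1..n}" using hall_is_X[of W] inv_into_into[of W X "{1..n}"] by blast
qed

lemma bracket_ind_entries: 
  assumes "j \<in> {2..n}"
  shows "bracket_ind (entries j) = X j" "hall (bracket_ind (entries j))"
proof -
  have "X j \<noteq> Gen1" using X1 inj_onD[OF inj_X, of j 1] assms by fastforce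
  then show "bracket_ind (entries j) = X j"
    using assms map_X_entries[of j] bracket_list_right_entries[of "X j"] hall_X[of j] 
    by (simp add: bracket_ind_def)
  then show "hall (bracket_ind (entries j))" using hall_X[of j] assms by simp
qed

lemma entries_unique:
  assumes "j \<in> {1..n}" "set ks \<subseteq> {1..n}" "X j = bracket_ind ks"
  shows "entries j = ks"
proof -
  have "right_entries (X j) = map X ks" using assms by (simp add: bracket_ind_def)
  then show ?thesis unfolding entries_def using assms(2) inj_X
    by (auto intro!: map_idI simp: subset_iff)
qed

lemma bracket_ind_is_X:
  assumes "hall (bracket_ind ks)" "set ks \<subseteq> {1..n}" "ks \<noteq> []"
  shows "\<exists>l\<in>{3..n}. entries l = ks"
proof -
  obtain l where l: "l \<in> {1..n}" "bracket_ind ks = X l" using hall_is_X assms by blast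
  then have e: "entries l = ks" using entries_unique assms by metis
  have "l \<noteq> 1" using l X1 bracket_ind_neq_Gen1 by metis
  moreover have "l \<noteq> 2" using e assms X2 by (auto simp: entries_def)
  ultimately show ?thesis using e l by force
qed

text \<open>The innermost bracket has left entry \<open>X 2\<close>, so its right entry must be
  smaller than \<open>X 2\<close>.\<close>

lemma hd_entries:
  assumes "j \<in> {3..n}"
  shows "entries j \<noteq> []" "hd (entries j) = 1"
proof -
  have h: "bracket_ind (entries j) = X j" "hall (bracket_ind (entries j))"
    using bracket_ind_entries assms by auto
  show ne: "entries j \<noteq> []"
  proof
    assume "entries j = []"
    then have "X j = X 2" using h X2 by simp
    then show False using inj_onD[OF inj_X, of j 2] assms by auto
  qed
  then obtain y vs where y: "entries j = y # vs" by (cases "entries j") auto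
  then have "hall (bracket_ind ([] @ [y]))" using hall_bracket_ind_append[of "[y]" vs] h by simp
  then have "lt (X y) (X 2)" using X2 by (simp add: hall_Bracket_iff del: append_Nil)
  moreover have "y \<in> {1..n}" using set_entries[of j] assms y by auto
  ultimately have "y < 2" using lt_X_iff[of y 2] n_ge_3 by auto
  then show "hd (entries j) = 1" using y \<open>y \<in> _\<close> by auto
qed

section \<open>Exchanging an entry\<close>

text \<open>The multi-index \<open>I(j)\<close> as a multiset: the multiplicity of \<open>r\<close>
  is the exponent of \<open>x r\<close> in the monomial of \<open>j\<close>, see
  \<open>count_ents\<close>.\<close>

definition ents :: "nat \<Rightarrow> nat multiset" where
  "ents j = mset (entries j)"

abbreviation wt :: "nat multiset \<Rightarrow> nat" where
  "wt M \<equiv> (\<Sum>i\<in>#M. len i)"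

lemma sum_list_len: "sum_list (map len ks) = wt (mset ks)"
  by (metis mset_map sum_mset_sum_list)

lemma len_eq: "j \<in> {2..n} \<Longrightarrow> len j = 1 + wt (ents j)"
  by (metis bracket_ind_entries(1) ents_def hall_length_bracket_ind sum_list_len)

lemma set_ents: "j \<in> {1..n} \<Longrightarrow> set_mset (ents j) \<subseteq> {1..n}"
  using set_entries by (simp add: ents_def)

lemma hall_length_le: "hall Z \<Longrightarrow> hall_length Z \<le> s"
  using two_le_s by (cases Z) (auto simp: hall_Bracket_iff)

lemma ents_split:
  assumes "j \<in> {2..n}" "y \<in># ents j"
  obtains us vs where "us = filter (\<lambda>i. i < y) (entries j)" "entries j = us @ y # vs"
    "\<forall>v\<in>set vs. y \<le> v" "hall (bracket_ind us)" "lt (X y) (bracket_ind us)" 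
    "hall_length (bracket_ind us) = 1 + wt (filter_mset (\<lambda>i. i < y) (ents j))"
    "len y \<le> 1 + wt (filter_mset (\<lambda>i. i < y) (ents j))"
proof -
  have j: "hall (bracket_ind (entries j))" "set (entries j) \<subseteq> {1..n}" "y \<in> set (entries j)"
    using assms bracket_ind_entries[of j] set_entries[of j] by (auto simp: ents_def)
  obtain us vs where us: "us = filter (\<lambda>i. i < y) (entries j)" "entries j = us @ y # vs"
    "\<forall>v\<in>set vs. y \<le> v" "hall (bracket_ind us)" "lt (X y) (bracket_ind us)"
    using hall_split[OF j] by blast
  have l: "hall_length (bracket_ind us) = 1 + wt (filter_mset (\<lambda>i. i < y) (ents j))"
    unfolding us(1) by (simp add: hall_length_bracket_ind sum_list_len ents_def)
  have "y \<in> {1..n}" using j by auto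
  then have "len y \<le> hall_length (bracket_ind us)"
    using us(4,5) length_le hall_X by blast
  then show thesis using that[OF us l] l by simp
qed

text \<open>\<open>X y\<close> is at most as long as the prefix before it, and that prefix is
  shorter than \<open>X k\<close>.\<close>

lemma ents_less:
  assumes "k \<in> {2..n}" "y \<in># ents k"
  shows "y < k"
proof -
  obtain us vs where *: "entries k = us @ y # vs" 
    "hall_length (bracket_ind us) = 1 + wt (filter_mset (\<lambda>i. i < y) (ents k))"
    "len y \<le> 1 + wt (filter_mset (\<lambda>i. i < y) (ents k))"
    using ents_split[OF assms] by metis
  have y: "y \<in> {1..n}" using assms set_ents[of k] by auto
  have "len k = 1 + sum_list (map len (entries k))"
    using assms bracket_ind_entries(1) hall_length_bracket_ind by metis
  then have "len k > hall_length (bracket_ind us)"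
    using *(1) hall_length_pos[of "X y"] by (simp add: hall_length_bracket_ind)
  then have "len y < len k" using *(2,3) by simp
  then have "lt (X y) (X k)" using y assms hall_X lt_length by simp
  then show ?thesis using lt_X_iff y assms by auto
qed

lemma ents_2 [simp]: "ents 2 = {#}"
  by (simp add: ents_def entries_def X2)

lemma ents_eqI:
  "l \<in> {1..n} \<Longrightarrow> set ks \<subseteq> {1..n} \<Longrightarrow> X l = bracket_ind ks \<Longrightarrow> ents l = mset ks"
  using entries_unique by (simp add: ents_def)

lemma one_in_ents: "j \<in> {3..n} \<Longrightarrow> 1 \<in># ents j"
  using hd_entries[of j] by (metis ents_def hd_in_set set_mset_mset)

text \<open>All indices are at least 1, so sorting \<open>M\<close> puts a 1 in front and
  \<open>hall_bracket_indI\<close> applies.\<close>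

lemma ents_exI:
  assumes M: "set_mset M \<subseteq> {1..n}" "1 \<in># M" "1 + wt M \<le> s"
    and y: "\<And>y. y \<in># M \<Longrightarrow> y \<noteq> 1 \<Longrightarrow> len y < 1 + wt (filter_mset (\<lambda>i. i < y) M)"
  shows "\<exists>l\<in>{3..n}. ents l = M"
proof -
  define ks where "ks = sorted_list_of_multiset M"
  have m: "mset ks = M" and s: "sorted ks" by (simp_all add: ks_def)
  then have set: "set ks = set_mset M" by (metis set_mset_mset)
  have ne: "ks \<noteq> []" using M(2) m by auto
  have "hall (bracket_ind ks)"
  proof (rule hall_bracket_indI[OF s])
    show "hd ks = 1"
    proof (cases ks)
      case (Cons a as)
      then have "a \<in> set_mset M" "1 \<in> set (a # as)" "sorted (a # as)"
        using s set M(2) by auto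
      then have "1 \<le> a" "a \<le> 1" using M(1) by auto
      then show ?thesis using Cons by simp
    qed (use ne in simp)
    show "len y < 1 + sum_list (map len (filter (\<lambda>i. i < y) ks))" if "y \<in> set ks" "y \<noteq> 1" for y
      using that y[of y] set m by (simp add: sum_list_len)
  qed (use M m set X1 in \<open>simp_all add: sum_list_len\<close>)
  then obtain l where "l \<in> {3..n}" "entries l = ks"
    using bracket_ind_is_X[of ks] ne set M(1) by metis
  then show ?thesis using m ents_def by auto
qed

text \<open>The exponents of \<open>x\<^sub>1 p\<^sub>k \<partial>p\<^sub>j/\<partial>x\<^sub>k\<close>.\<close>

definition exchange :: "nat \<Rightarrow> nat \<Rightarrow> nat multiset" where
  "exchange j k = ents j - {#k#} + {#1#} + ents k"

text \<open>The length of \<open>X k\<close> is that of its entries plus one for the leftmost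
  \<open>Gen2\<close>; the new 1 makes up for this \<open>Gen2\<close>.\<close>

lemma wt_exchange:
  assumes "j \<in> {3..n}" "k \<in># ents j" "2 \<le> k"
  shows "1 + wt (exchange j k) = len j"
proof -
  have k: "k \<in> {2..n}" using assms set_ents[of j] by auto
  define N where "N = ents j - {#k#}"
  have "ents j = N + {#k#}" using assms(2) by (simp add: N_def)
  then have "wt (ents j) = len k + wt N" by simp
  then show ?thesis
    using len_eq[of k] len_eq[of j] k assms X1 by (simp add: exchange_def flip: N_def)
qed

text \<open>If the criterion of \<open>ents_exI\<close> fails at some \<open>y\<close>, then
  \<open>y\<close> is an entry of \<open>X j\<close> above \<open>k\<close>. The exchange then keeps
  the length of the prefix before \<open>y\<close>, so this length is both at least and at most
  \<open>len y\<close>.\<close>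

lemma exchange_cases:
  assumes j: "j \<in> {3..n}" and k: "k \<in># ents j" "2 \<le> k"
  obtains (hall) l where "l \<in> {3..n}" "ents l = exchange j k"
  | (tie) us y vs where "entries j = us @ y # vs" "\<forall>v\<in>set vs. y \<le> v"
      "hall (bracket_ind us)" "lt (X y) (bracket_ind us)" "hall_length (bracket_ind us) = len y"
      "k \<in> set us" "1 \<in> set us"
proof (cases "\<exists>y. y \<in># exchange j k \<and> y \<noteq> 1 \<and>
    1 + wt (filter_mset (\<lambda>i. i < y) (exchange j k)) \<le> len y")
  case False
  have kn: "k \<in> {2..n}" using k set_ents[of j] j by auto
  have "\<exists>l\<in>{3..n}. ents l = exchange j k"
  proof (rule ents_exI)
    show "set_mset (exchange j k) \<subseteq> {1..n}"
      using set_ents[of j] set_ents[of k] j kn by (auto simp: exchange_def dest: in_diffD)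
    show "1 + wt (exchange j k) \<le> s"
      using wt_exchange[OF j k] hall_length_le hall_X j by simp
  qed (use False in \<open>auto simp: exchange_def not_le\<close>)
  then show thesis using hall by blast
next
  case True
  then obtain y where y: "y \<in># exchange j k" "y \<noteq> 1"
    "1 + wt (filter_mset (\<lambda>i. i < y) (exchange j k)) \<le> len y" by blast
  define N where "N = ents j - {#k#}"
  have Ij: "ents j = N + {#k#}" using k by (simp add: N_def)
  have kn: "k \<in> {2..n}" using k set_ents[of j] j by auto
  have j2: "j \<in> {2..n}" using j by auto
  have yn: "y \<in> {1..n}"
    using y set_ents[of j] set_ents[of k] j kn by (auto simp: exchange_def dest: in_diffD)
  let ?f = "\<lambda>M. wt (filter_mset (\<lambda>i. i < y) M)"
  have f: "?f (exchange j k) = ?f N + 1 + ?f (ents k)"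
    using yn y(2) X1 by (simp add: exchange_def flip: N_def)
  have fj: "?f (ents j) = ?f N + (if k < y then len k else 0)" by (simp add: Ij)
  \<comment> \<open>The prefix before an entry \<open>y\<close> inside \<open>X k\<close> is already
    as long as \<open>X y\<close>, and the new 1 makes it strictly longer.\<close>
  have nk: "y \<notin># ents k"
  proof
    assume "y \<in># ents k"
    then have "len y \<le> 1 + ?f (ents k)" using ents_split[OF kn] by metis
    then show False using y(3) f by simp
  qed
  then have yN: "y \<in># N" using y by (auto simp: exchange_def N_def)
  then have yj: "y \<in># ents j" by (simp add: Ij)
  obtain us vs where us: "us = filter (\<lambda>i. i < y) (entries j)" "entries j = us @ y # vs"
    "\<forall>v\<in>set vs. y \<le> v" "hall (bracket_ind us)" "lt (X y) (bracket_ind us)" 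
    "hall_length (bracket_ind us) = 1 + ?f (ents j)" "len y \<le> 1 + ?f (ents j)"
    using ents_split[OF j2 yj] by metis
  \<comment> \<open>Were \<open>k\<close> not below \<open>y\<close>, the exchange would only add to
    the weight below \<open>y\<close>, at least by the new 1.\<close>
  have ky: "k < y" using us(7) y(3) f fj by (cases "k < y") auto
  have "filter_mset (\<lambda>i. i < y) (ents k) = ents k"
    using ents_less[OF kn] less_trans[OF _ ky] by (auto simp: filter_mset_eq_conv)
  then have "?f (exchange j k) = ?f (ents j)"
    using f fj ky len_eq[OF kn] by simp
  then have "hall_length (bracket_ind us) = len y" using us(6,7) y(3) by simp
  moreover have "k \<in> set us" "1 \<in> set us"
    using us(1) ky k kn one_in_ents[OF j] by (auto simp: ents_def)
  ultimately show thesis using tie us by blast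
qed

section \<open>Ties up to length eight\<close>

lemma bracket_ind_inj:
  assumes "bracket_ind us = bracket_ind vs" "set us \<subseteq> {1..n}" "set vs \<subseteq> {1..n}"
  shows "us = vs"
proof -
  have "right_entries (bracket_ind us) = right_entries (bracket_ind vs)" using assms(1) by simp
  then have "map X us = map X vs" by (simp add: bracket_ind_def)
  then show ?thesis using inj_X assms(2,3) by (metis inj_on_map_eq_map inj_on_subset sup_least)
qed

lemma bracket_ind_numerals: 
  "bracket_ind [1, 1] = Bracket (Bracket Gen2 Gen1) Gen1"
  "bracket_ind [1, 2] = Bracket (Bracket Gen2 Gen1) Gen2"
  "bracket_ind [1, 1, 1] = Bracket (Bracket (Bracket Gen2 Gen1) Gen1) Gen1"
  "bracket_ind [1, 1, 2] = Bracket (Bracket (Bracket Gen2 Gen1) Gen1) Gen2"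
  "bracket_ind [1, 2, 2] = Bracket (Bracket (Bracket Gen2 Gen1) Gen2) Gen2"
  by (simp_all add: bracket_ind_def bracket_list_def X1[simplified] X2)

lemma ents_4: "3 \<le> s \<Longrightarrow> ents 4 = {#1, 1#}"
  using ents_eqI[of 4 "[1,1]"] n_ge_5 bracket_ind_numerals X4 by auto

lemma ents_6: "4 \<le> s \<Longrightarrow> ents 6 = {#1, 1, 1#}"
  using ents_eqI[of 6 "[1,1,1]"] n_ge_8 bracket_ind_numerals X6 by auto

lemma ents_7: "4 \<le> s \<Longrightarrow> ents 7 = {#1, 1, 2#}"
  using ents_eqI[of 7 "[1,1,2]"] n_ge_8 bracket_ind_numerals X7 by auto

text \<open>Only a tie needs work: it forces \<open>len y\<close> to be 3 or 4 with nothing after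
  \<open>y\<close>, and the few remaining cases are computed. The bound \<open>6 \<le> s\<close>
  records that the extra factor \<open>x l\<close> first arises in length six; this gives
  \<open>b = 0\<close> for \<open>s \<le> 5\<close>.\<close>

lemma exchange_8:
  assumes j: "j \<in> {3..n}" and k: "k \<in># ents j" "2 \<le> k" and "s \<le> 8"
  shows "(\<exists>l\<in>{3..n}. exchange j k = ents l) \<or>
    6 \<le> s \<and> (\<exists>l\<in>{3..n}. exchange j k = ents l + {#l#})"
  using j k
proof (cases rule: exchange_cases)
  case hall
  then show ?thesis by metis
next
  case (tie us y vs)
  have yn: "y \<in> {1..n}" "set us \<subseteq> {1..n}" "set vs \<subseteq> {1..n}"
    using set_entries[of j] tie(1) j by auto
  have lj: "len j = len y + len y + sum_list (map len vs)"
    using bracket_ind_entries[of j] tie(1,5) j hall_length_bracket_ind[of "entries j"]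
    by (simp add: hall_length_bracket_ind)
  have l8: "len j \<le> s" using hall_length_le hall_X j by simp
  \<comment> \<open>The prefix contains a 1 and, as \<open>k\<close> is not 1, a separate entry
    \<open>k\<close>; with the leftmost \<open>Gen2\<close> its length is at least three.\<close>
  obtain A where A: "mset us = add_mset 1 A" using tie(7) by (metis multi_member_split set_mset_mset)
  moreover have "k \<in># mset us" using tie(6) by simp
  ultimately have "k \<in># A" using k(2) by auto
  then obtain B where "A = add_mset k B" by (metis multi_member_split)
  then have "wt (mset us) = 1 + len k + wt B" using A X1 by simp
  moreover have "1 + wt (mset us) = len y"
    using tie(5) hall_length_bracket_ind[of us] by (simp add: sum_list_len)
  ultimately have L3: "3 \<le> len y" using hall_length_pos[of "X k"] by simp
  \<comment> \<open>A further entry would be at least as long as \<open>X y\<close>, making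
    \<open>X j\<close> at least three times as long as \<open>X y\<close>, hence of length at least
    nine.\<close>
  have vs: "vs = []"
  proof (cases vs)
    case (Cons v ws)
    then have "len y \<le> len v"
      using tie(2) yn length_le[of "X y" "X v"] hall_X lt_X_iff[of y v]
      by (cases "y = v") auto
    then show ?thesis using lj l8 L3 \<open>s \<le> 8\<close> Cons by simp
  qed simp
  have ej: "ents j = add_mset y (mset us)" using tie(1) vs by (simp add: ents_def)
  have "len y = 3 \<or> len y = 4" using L3 lj l8 \<open>s \<le> 8\<close> by auto
  then show ?thesis
  proof
    assume L: "len y = 3"
    then have s: "6 \<le> s" using lj l8 by simp
    have n5: "5 \<le> n" using n_ge_5 s by simp
    have X45': "X 4 = bracket_ind [1, 1]" "X 5 = bracket_ind [1, 2]" 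
      using X4 X5 s bracket_ind_numerals by auto
    have "bracket_ind us = bracket_ind [1,1] \<or> bracket_ind us = bracket_ind [1,2]"
      using hall_length_3[OF tie(3)] tie(5) L bracket_ind_numerals by simp
    then have "us = [1,1] \<or> us = [1,2]"
      using bracket_ind_inj[of us "[1,1]"] bracket_ind_inj[of us "[1,2]"] yn n5 by auto
    \<comment> \<open>An index at least 2 occurs in the prefix, so the prefix is \<open>X 5\<close>.
      The smaller \<open>X y\<close> must be \<open>X 4\<close>, and the exchange turns
      \<open>{#1, 2, 4#}\<close> into \<open>{#1, 1, 4#}\<close>.\<close>
    then have us: "us = [1,2]" "k = 2" using tie(6) k(2) by auto
    then have "lt (X y) (X 5)" using tie(4) X45' by simp
    then have "y < 5" using lt_X_iff[of y 5] yn n5 by simp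
    moreover have "X y = X 4 \<or> X y = X 5"
      using hall_length_3[OF hall_X L] yn X4 X5 s by simp
    then have "y = 4 \<or> y = 5" using inj_onD[OF inj_X, of y] yn n5 by auto
    ultimately have "exchange j k = ents 4 + {#4#}"
      using ej us ents_4 s by (auto simp: exchange_def)
    then show ?thesis using s n5 by force
  next
    assume L: "len y = 4"
    then have s: "8 \<le> s" using lj l8 by simp
    have n8: "8 \<le> n" using n_ge_8 s by simp
    have X678': "X 6 = bracket_ind [1, 1, 1]" "X 7 = bracket_ind [1, 1, 2]" "X 8 = bracket_ind [1, 2, 2]" 
      using X6 X7 X8 s bracket_ind_numerals by auto
    have "bracket_ind us \<in> bracket_ind ` {[1,1,1],[1,1,2],[1,2,2]}"
      using hall_length_4[OF tie(3)] tie(5) L bracket_ind_numerals by auto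
    then have "us \<in> {[1,1,1],[1,1,2],[1,2,2]}"
      using bracket_ind_inj[of us "[1,1,1]"] bracket_ind_inj[of us "[1,1,2]"]
        bracket_ind_inj[of us "[1,2,2]"] yn n8 by auto
    \<comment> \<open>An index at least 2 in the prefix can only be 2, which excludes
      \<open>X 6\<close> as prefix.\<close>
    then have k: "k = 2" and us: "us = [1,1,2] \<or> us = [1,2,2]" using tie(6) k(2) by auto
    have "X y = X 6 \<or> X y = X 7 \<or> X y = X 8"
      using hall_length_4[OF hall_X L] yn X6 X7 X8 s by simp
    then have y: "y = 6 \<or> y = 7 \<or> y = 8" using inj_onD[OF inj_X, of y] yn n8 by auto
    from us show ?thesis
    proof
      assume us: "us = [1,1,2]"
      then have "y < 7" using lt_X_iff[of y 7] tie(4) X678' yn n8 by simp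
      then have "exchange j k = ents 6 + {#6#}"
        using y ej us k ents_6 s by (auto simp: exchange_def)
      then show ?thesis using s n8 by force
    next
      assume us: "us = [1,2,2]"
      then have "y < 8" using lt_X_iff[of y 8] tie(4) X678' yn n8 by simp
      then consider "y = 6" | "y = 7" using y by auto
      then show ?thesis
      proof cases
        case 1
        \<comment> \<open>The exchange turns the prefix \<open>X 8\<close> into \<open>X 7\<close>,
          still greater than \<open>X 6\<close>, so \<open>[X 7, X 6]\<close> is a Hall element
          despite the equal lengths.\<close>
        have "hall (bracket_ind ([1,1,2] @ [6]))"
          using X678' hall_X[of 7] lt_X_iff[of 6 7] n8 s X1 X2 L 1
          by (subst hall_bracket_ind_snoc) auto
        then obtain l where "l \<in> {3..n}" "entries l = [1,1,2,6]"
          using bracket_ind_is_X[of "[1,1,2,6]"] n8 by auto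
        moreover have "exchange j k = mset [1,1,2,6]"
          using 1 ej us k by (simp add: exchange_def)
        ultimately show ?thesis by (metis ents_def)
      next
        case 2
        then have "exchange j k = ents 7 + {#7#}"
          using ej us k ents_7 s by (simp add: exchange_def)
        then show ?thesis using s n8 by force
      qed
    qed
  qed
qed

lemma count_ents: 
  assumes "j \<in> {1..n}" "r \<in> {1..n}"
  shows "hall_exponent X j r = count (ents j) r"
proof -
  have "count_list (map X ks) (X r) = count (mset ks) r" if "set ks \<subseteq> {1..n}" for ks
    using that inj_onD[OF inj_X _ _ assms(2)] by (induction ks) auto
  then show ?thesis
    using map_X_entries[OF assms(1)] set_entries[OF assms(1)] 
    by (metis ents_def hall_exponent_def)
qed

end

section \<open>Monomials and the equation\<close>

definition mon :: "nat multiset \<Rightarrow> (nat \<Rightarrow> real) \<Rightarrow> real" where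
  "mon M x = (\<Prod>r\<in>#M. x r)"

lemma mon_simps [simp]:
  "mon {#} x = 1" "mon (add_mset r M) x = x r * mon M x" "mon (M + N) x = mon M x * mon N x"
  by (simp_all add: mon_def)

lemma mon_fun_upd:
  assumes "M = N + replicate_mset m k" "k \<notin># N"
  shows "mon M (x(k := t)) = mon N x * t ^ m"
proof -
  have "mon N (x(k := t)) = mon N x"
    unfolding mon_def using assms(2) by (intro arg_cong[of _ _ prod_mset] image_mset_cong) auto
  then show ?thesis using assms(1) by (simp add: mon_def)
qed

lemma partial_deriv_mon:
  "partial_deriv k (\<lambda>x. c * mon M x) x = c * count M k * mon (M - {#k#}) x"
proof -
  define N m where "N = filter_mset (\<lambda>r. r \<noteq> k) M" and "m = count M k"
  have M: "M = N + replicate_mset m k" and N: "k \<notin># N"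
    by (auto simp: N_def m_def multiset_eq_iff)
  have "((\<lambda>t. c * mon M (x(k := t))) has_field_derivative
      c * (mon N x * (m * x k ^ (m - 1)))) (at (x k))"
    unfolding mon_fun_upd[OF M N] by (auto intro!: derivative_eq_intros)
  then have "partial_deriv k (\<lambda>x. c * mon M x) x = c * (mon N x * (m * x k ^ (m - 1)))"
    unfolding partial_deriv_def by (rule DERIV_imp_deriv)
  moreover have "mon (M - {#k#}) x = mon N x * x k ^ (m - 1)" if "m \<noteq> 0"
  proof -
    have "M - {#k#} = N + replicate_mset (m - 1) k" using that M by (cases m) auto
    then show ?thesis by (simp add: mon_def)
  qed
  ultimately show ?thesis by (cases "m = 0") (auto simp flip: m_def)
qed

lemma partial_deriv_ansatz:
  assumes "l \<in> {3..n}"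
  shows "partial_deriv l (ansatz n a b) x = a l + 2 * b l * x l"
proof -
  have coord: "((\<lambda>t. (x(l := t)) k) has_field_derivative (if k = l then 1 else 0)) (at (x l))" for k
    by (cases "k = l") auto
  have sq: "((\<lambda>t. b k * ((x(l := t)) k)\<^sup>2) has_field_derivative b k * (if k = l then 2 * x l else 0))
      (at (x l))" for k
    by (rule DERIV_cmult[THEN DERIV_cong], rule DERIV_power[OF coord]) auto
  have "((\<lambda>t. ansatz n a b (x(l := t))) has_field_derivative
     (\<Sum>k=3..n. a k * (if k = l then 1 else 0)) +
     (\<Sum>k=3..n. b k * (if k = l then 2 * x l else 0))) (at (x l))"
    unfolding ansatz_def by (intro DERIV_add DERIV_sum DERIV_cmult[OF coord] sq)
  then show ?thesis
    unfolding partial_deriv_def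
    by (rule HOL.trans[OF DERIV_imp_deriv]) (use assms in \<open>simp add: if_distrib cong: if_cong\<close>)
qed

context hall_numbering
begin

definition coef :: "nat \<Rightarrow> real" where
  "coef j = (- 1) ^ hall_depth X j / (\<Prod>r=1..n. fact (hall_exponent X j r))"

lemma coef_nonzero: "coef j \<noteq> 0"
  by (simp add: coef_def)

lemma hall_monomial_eq:
  assumes "j \<in> {1..n}"
  shows "hall_monomial n X j = (\<lambda>x. coef j * mon (ents j) x)"
proof
  fix x :: "nat \<Rightarrow> real"
  have "(\<Prod>r=1..n. x r ^ hall_exponent X j r) = (\<Prod>r=1..n. x r ^ count (ents j) r)"
    using count_ents[OF assms] by simp
  also have "\<dots> = (\<Prod>r\<in>set_mset (ents j). x r ^ count (ents j) r)"
    by (rule prod.mono_neutral_right) (use set_ents[OF assms] in \<open>auto simp: not_in_iff\<close>)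
  also have "\<dots> = mon (ents j) x" by (simp add: mon_def image_prod_mset_multiplicity)
  finally show "hall_monomial n X j x = coef j * mon (ents j) x"
    by (simp add: hall_monomial_def coef_def)
qed

text \<open>The defining formula gives \<open>p\<^sub>2 = 1\<close>, which lets the derivative in \<open>x\<^sub>2\<close> join the sum.\<close>

lemma hall_monomial_2: "hall_monomial n X 2 x = 1"
  by (simp add: hall_monomial_def hall_exponent_def hall_depth_def X2)

text \<open>A summand of the part of the equation without the unknown function, with
  \<open>k = 2\<close> standing for the derivative in \<open>x 2\<close>. If \<open>k\<close> is an
  entry of \<open>X j\<close>, the monomial is that of \<open>exchange j k\<close>.\<close>

definition drift_term :: "nat \<Rightarrow> nat \<Rightarrow> (nat \<Rightarrow> real) \<Rightarrow> real" where
  "drift_term j k x = hall_const X j * coef j * coef k * count (ents j) k *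
     (x 1 * mon (ents j - {#k#}) x * mon (ents k) x)"

definition ansatz_drift :: "(nat \<Rightarrow> real) \<Rightarrow> (nat \<Rightarrow> real) \<Rightarrow> (nat \<Rightarrow> real) \<Rightarrow> real" where
  "ansatz_drift a b x = (\<Sum>l=3..n. coef l * mon (ents l) x * (a l + 2 * b l * x l))"

lemma solves_eq_iff:
  assumes "j \<in> {3..n}"
  shows "solves_eq n X j (ansatz n a b) \<longleftrightarrow>
    (\<forall>x. (\<Sum>k=2..n. drift_term j k x) + ansatz_drift a b x = 0)"
proof -
  let ?p = "hall_monomial n X"
  have "hall_const X j * x 1 * (partial_deriv 2 (?p j) x + (\<Sum>k=3..n. ?p k x * partial_deriv k (?p j) x))
    = (\<Sum>k=2..n. drift_term j k x)" for x
  proof -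
    have "partial_deriv 2 (?p j) x + (\<Sum>k=3..n. ?p k x * partial_deriv k (?p j) x) =
      (\<Sum>k=2..n. ?p k x * partial_deriv k (?p j) x)"
      using n_ge_3 by (subst sum.atLeast_Suc_atMost[of 2]) (simp_all add: hall_monomial_2 numeral_3_eq_3)
    moreover have "hall_const X j * x 1 * (?p k x * partial_deriv k (?p j) x) = drift_term j k x"
      if "k \<in> {2..n}" for k
      using that assms by (simp add: hall_monomial_eq partial_deriv_mon drift_term_def)
    ultimately show ?thesis by (simp add: sum_distrib_left)
  qed
  moreover have "(\<Sum>l=3..n. ?p l x * partial_deriv l (ansatz n a b) x) = ansatz_drift a b x" for x
    by (simp add: ansatz_drift_def partial_deriv_ansatz hall_monomial_eq)
  ultimately show ?thesis unfolding solves_eq_def Let_def by simp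
qed

section \<open>Solvability up to step eight\<close>

lemma drift_term_solvable:
  assumes j: "j \<in> {3..n}" and k: "k \<in> {2..n}" and "s \<le> 8"
  shows "\<exists>a b. (\<forall>x. drift_term j k x + ansatz_drift a b x = 0) \<and> (s \<le> 5 \<longrightarrow> (\<forall>l. b l = 0))"
proof (cases "k \<in># ents j")
  case False
  then have "drift_term j k x + ansatz_drift (\<lambda>_. 0) (\<lambda>_. 0) x = 0" for x
    by (simp add: drift_term_def ansatz_drift_def not_in_iff)
  then show ?thesis by blast
next
  case True
  define C where "C = hall_const X j * coef j * coef k * count (ents j) k"
  have C: "drift_term j k x = C * mon (exchange j k) x" for x
    by (simp add: drift_term_def exchange_def C_def)
  consider l where "l \<in> {3..n}" "exchange j k = ents l"
    | l where "6 \<le> s" "l \<in> {3..n}" "exchange j k = ents l + {#l#}"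
    using exchange_8[OF j True] k \<open>s \<le> 8\<close> by auto
  then show ?thesis
  proof cases
    case 1
    have "drift_term j k x + ansatz_drift (\<lambda>i. if i = l then - C / coef l else 0) (\<lambda>_. 0) x = 0" for x
      using 1 coef_nonzero[of l]
      by (simp add: C ansatz_drift_def if_distrib[of "(*) _"] cong: if_cong)
    then show ?thesis by blast
  next
    case 2
    \<comment> \<open>The square of \<open>x l\<close> contributes \<open>2 * x l\<close> times the
      monomial of \<open>l\<close>, whence the 2 in the denominator.\<close>
    have "drift_term j k x + ansatz_drift (\<lambda>_. 0) (\<lambda>i. if i = l then - C / (2 * coef l) else 0) x = 0" for x
    proof -
      have "ansatz_drift (\<lambda>_. 0) (\<lambda>i. if i = l then - C / (2 * coef l) else 0) x =
        (\<Sum>i=3..n. if i = l then coef i * mon (ents i) x * (2 * (- C / (2 * coef l)) * x i) else 0)"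
        unfolding ansatz_drift_def by (rule sum.cong) auto
      also have "\<dots> = coef l * mon (ents l) x * (2 * (- C / (2 * coef l)) * x l)"
        using 2 by simp
      finally show ?thesis using 2 coef_nonzero[of l] by (simp add: C)
    qed
    then show ?thesis using 2(1) by (intro exI conjI) auto
  qed
qed

text \<open>The contribution of the ansatz is linear in its coefficients, so the coefficients
  cancelling the single drift terms may be added up.\<close>

lemma solvable:
  assumes j: "j \<in> {3..n}" and "s \<le> 8"
  shows "\<exists>a b. solves_eq n X j (ansatz n a b) \<and> (s \<le> 5 \<longrightarrow> (\<forall>l\<in>{3..n}. b l = 0))"
proof -
  have "\<forall>k\<in>{2..n}. \<exists>a b. (\<forall>x. drift_term j k x + ansatz_drift a b x = 0) \<and> (s \<le> 5 \<longrightarrow> (\<forall>l. b l = 0))"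
    using drift_term_solvable[OF j _ \<open>s \<le> 8\<close>] by blast
  then obtain a b where ab: "\<And>k x. k \<in> {2..n} \<Longrightarrow> drift_term j k x + ansatz_drift (a k) (b k) x = 0"
    "\<And>k l. k \<in> {2..n} \<Longrightarrow> s \<le> 5 \<Longrightarrow> b k l = 0"
    by metis
  define A B where "A l = (\<Sum>k=2..n. a k l)" and "B l = (\<Sum>k=2..n. b k l)" for l
  have "ansatz_drift A B x = (\<Sum>k=2..n. ansatz_drift (a k) (b k) x)" for x
    unfolding ansatz_drift_def A_def B_def
    by (subst sum.swap)
      (simp add: sum.distrib sum_distrib_left sum_distrib_right distrib_left)
  then have "(\<Sum>k=2..n. drift_term j k x) + ansatz_drift A B x = 0" for x
    using ab(1) by (simp flip: sum.distrib)
  moreover have "s \<le> 5 \<longrightarrow> (\<forall>l\<in>{3..n}. B l = 0)" using ab(2) by (simp add: B_def)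
  ultimately show ?thesis using solves_eq_iff[OF j] by blast
qed

section \<open>Unsolvability from step nine on\<close>

definition probe :: "real \<Rightarrow> real \<Rightarrow> nat \<Rightarrow> real" where
  "probe t u r = (if r = 1 then t else if r = 4 then u else 0)"

lemma probe_simps [simp]: "probe t u (Suc 0) = t" "probe t u 4 = u"
  by (simp_all add: probe_def)

text \<open>The coordinate \<open>u\<close> contributes factors of modulus at most one, so only the
  powers of \<open>t\<close> remain.\<close>

lemma mon_probe_le:
  assumes "set_mset M \<subseteq> {1, 4}" "0 \<le> t" "t \<le> 1" "\<bar>u\<bar> \<le> 1"
  shows "\<bar>mon M (probe t u)\<bar> \<le> t ^ count M 1"
  using assms(1)
proof (induction M)
  case (add r M)
  then have "\<bar>mon M (probe t u)\<bar> \<le> t ^ count M 1" by simp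
  moreover have "0 \<le> t ^ count M 1" using assms(2) by simp
  ultimately show ?case
    using add.prems assms(2,4) mult_mono[of "\<bar>u\<bar>" 1 "\<bar>mon M (probe t u)\<bar>" "t ^ count M 1"]
    by (auto simp: abs_mult mult_left_mono)
qed simp

lemma mon_probe_eq_0:
  assumes "\<not> set_mset M \<subseteq> {1, 4}"
  shows "mon M (probe t u) = 0"
proof -
  obtain r where r: "r \<in># M" "r \<notin> {1, 4}" using assms by blast
  then obtain N where "M = add_mset r N" by (metis multi_member_split)
  then show ?thesis using r by (simp add: probe_def)
qed

lemma mon_probe_const:
  assumes "4 \<notin># M"
  shows "mon M (probe t u) = mon M (probe t 0)"
  unfolding mon_def using assms
  by (intro arg_cong[of _ _ prod_mset] image_mset_cong) (auto simp: probe_def)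

text \<open>The prefix before the first 4 consists of ones and must exceed \<open>X 4\<close>, which
  is itself the bracket with two ones.\<close>

lemma count_1_ge_3:
  assumes l: "l \<in> {3..n}" "4 \<in># ents l" "set_mset (ents l) \<subseteq> {1, 4}" and "3 \<le> s"
  shows "3 \<le> count (ents l) 1"
proof -
  have l2: "l \<in> {2..n}" using l by auto
  obtain us where us: "us = filter (\<lambda>i. i < 4) (entries l)" "hall (bracket_ind us)" "lt (X 4) (bracket_ind us)"
    using ents_split[OF l2 l(2)] by metis
  have "\<forall>i\<in>set us. i = 1" using us(1) l(3) by (auto simp: ents_def)
  then obtain m where rep: "us = replicate m 1" using replicate_length_same by metis
  have "\<not> length us \<le> 2"
  proof
    assume "length us \<le> 2"
    then have "m = 0 \<or> m = 1 \<or> m = 2" using rep by auto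
    then consider "us = []" | "us = [1]" | "us = [1,1]"
      using rep by (auto simp: numeral_2_eq_2)
    then have "hall_length (bracket_ind us) < 3 \<or> bracket_ind us = X 4"
      using bracket_ind_numerals(1) X4 X1 \<open>3 \<le> s\<close> by cases (auto simp: hall_length_bracket_ind)
    moreover have "hall_length (X 4) = 3" using X4 \<open>3 \<le> s\<close> by simp
    moreover have "4 \<in> {1..n}" using n_ge_5 \<open>3 \<le> s\<close> by auto
    ultimately show False using us(2,3) length_le lt_irrefl hall_X by (metis not_le)
  qed
  moreover have "length us \<le> count (ents l) 1"
  proof -
    have "mset us \<subseteq># ents l" using us(1) by (simp add: ents_def)
    then have "count (mset us) 1 \<le> count (ents l) 1" by (rule mset_subset_eq_count)
    moreover have "count (mset us) 1 = length us" by (simp add: rep)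
    ultimately show ?thesis by simp
  qed
  ultimately show ?thesis by simp
qed

text \<open>The second difference in \<open>x\<^sub>4\<close> kills every term that is affine in \<open>x\<^sub>4\<close>; the remaining
  \<open>p\<^sub>l\<close> that do not vanish at the probe points have \<open>x\<^sub>1\<close>-exponent at least three, whereas the
  monomial to be cancelled has \<open>x\<^sub>1\<close>-exponent two.\<close>

lemma second_difference_le:
  fixes a b :: real
  assumes l: "l \<in> {3..n}" and t: "0 \<le> t" "t \<le> 1" and "3 \<le> s"
  defines "G \<equiv> \<lambda>u. coef l * mon (ents l) (probe t u) * (a + 2 * b * probe t u l)"
  shows "\<bar>G 1 + G (- 1) - 2 * G 0\<bar> \<le> 4 * \<bar>coef l * a\<bar> * t ^ 3"
proof (cases "4 \<in># ents l")
  case False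
  \<comment> \<open>Without \<open>x 4\<close> in the monomial, \<open>G\<close> is affine in
    \<open>u\<close>: the \<open>b\<close> part is nonzero only for \<open>l = 4\<close>, where it
    is linear.\<close>
  then have "G 1 + G (- 1) - 2 * G 0 = 0"
    using l mon_probe_const[of "ents l" t 1] mon_probe_const[of "ents l" t "- 1"]
    by (auto simp: G_def probe_def algebra_simps)
  then show ?thesis using t by simp
next
  case True
  \<comment> \<open>\<open>X 4\<close> is not an entry of itself, so \<open>x l\<close> vanishes at
    the probe points and \<open>b\<close> drops out.\<close>
  have "l \<noteq> 4" using True ents_less[of l 4] l by auto
  then have G: "G u = coef l * a * mon (ents l) (probe t u)" for u
    using l by (simp add: G_def probe_def)
  have m: "\<bar>mon (ents l) (probe t u)\<bar> \<le> t ^ 3" if "\<bar>u\<bar> \<le> 1" for u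
  proof (cases "set_mset (ents l) \<subseteq> {1, 4}")
    case sub: True
    have "\<bar>mon (ents l) (probe t u)\<bar> \<le> t ^ count (ents l) 1"
      using mon_probe_le sub t that by blast
    also have "\<dots> \<le> t ^ 3" using count_1_ge_3[OF l True sub \<open>3 \<le> s\<close>] t by (intro power_decreasing)
    finally show ?thesis .
  qed (use mon_probe_eq_0 t in simp)
  have "\<bar>G u\<bar> \<le> \<bar>coef l * a\<bar> * t ^ 3" if "\<bar>u\<bar> \<le> 1" for u
    unfolding G abs_mult[of "coef l * a"] using m[OF that] by (intro mult_left_mono) auto
  from this[of 1] this[of "-1"] this[of 0] show ?thesis by simp
qed

lemma unsolvable:
  assumes "9 \<le> s"
  shows "\<exists>j\<in>{3..n}. \<forall>a b. \<not> solves_eq n X j (ansatz n a b)"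
proof -
  have n: "8 \<le> n" using n_ge_8 assms by simp
  have X45: "X 5 = bracket_ind [1, 2]" "X 4 = bracket_ind [1, 1]" "len 4 = 3"
    using X4 X5 assms bracket_ind_numerals by auto
  \<comment> \<open>Since \<open>X 4\<close> is smaller than \<open>X 5\<close>, their bracket is a
    Hall element of length six; bracketing with \<open>X 4\<close> once more gives length
    nine.\<close>
  have h4: "hall (bracket_ind ([1,2] @ [4]))"
    using X45 hall_X[of 5] lt_X_iff[of 4 5] n assms X1 X2
    by (subst hall_bracket_ind_snoc) auto
  have "lt (X 4) (bracket_ind ([1,2] @ [4]))"
    using h4 hall_X[of 4] n X45 X1 X2 by (intro lt_length) (auto simp: hall_length_bracket_ind simp del: append_Cons)
  then have "hall (bracket_ind (([1,2] @ [4]) @ [4]))"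
    using h4 n assms X1 X2 X45(3)
    by (subst hall_bracket_ind_snoc) auto
  then obtain j where j: "j \<in> {3..n}" "entries j = [1,2,4,4]"
    using bracket_ind_is_X[of "[1,2,4,4]"] n by auto
  then have ej: "ents j = {#1,2,4,4#}" by (simp add: ents_def)
  define K where "K = hall_const X j * coef j"
  have K: "K \<noteq> 0" using coef_nonzero[of j] by (simp add: K_def hall_const_def)
  have c2: "coef 2 = 1"
    using hall_monomial_2 hall_monomial_eq[of 2] n by simp
  have lhs: "(\<Sum>k=2..n. drift_term j k (probe t u)) = K * t\<^sup>2 * u\<^sup>2" for t u
  proof -
    have "drift_term j k (probe t u) = 0" if "k \<in> {3..n}" for k
    proof -
      \<comment> \<open>Removing an index \<open>k \<ge> 3\<close> leaves the 2 in place, and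
        \<open>x 2\<close> vanishes at the probe points.\<close>
      have "\<not> set_mset (ents j - {#k#}) \<subseteq> {1, 4}" using ej that by auto
      then show ?thesis by (simp add: drift_term_def mon_probe_eq_0)
    qed
    moreover have "drift_term j 2 (probe t u) = K * t\<^sup>2 * u\<^sup>2"
      by (simp add: drift_term_def ej c2 probe_def K_def power2_eq_square)
    ultimately show ?thesis
      using n by (subst sum.atLeast_Suc_atMost[of 2]) (simp_all add: numeral_3_eq_3)
  qed
  have "\<not> solves_eq n X j (ansatz n a b)" for a b
  proof
    assume "solves_eq n X j (ansatz n a b)"
    then have eq: "K * t\<^sup>2 * u\<^sup>2 + ansatz_drift a b (probe t u) = 0" for t u
      using solves_eq_iff[OF j(1)] lhs by metis
    define D where "D = (\<Sum>l=3..n. 4 * \<bar>coef l * a l\<bar>)"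
    have D: "0 \<le> D" unfolding D_def by (intro sum_nonneg) auto
    \<comment> \<open>The second difference of \<open>u\<^sup>2\<close> at 1, 0, -1 is 2, so the
      drift side is of exact order \<open>t\<^sup>2\<close>, while the ansatz side is of order at
      most \<open>t ^ 3\<close>.\<close>
    have bound: "2 * \<bar>K\<bar> * t\<^sup>2 \<le> D * t ^ 3" if t: "0 \<le> t" "t \<le> 1" for t
    proof -
      let ?E = "\<lambda>u. ansatz_drift a b (probe t u)"
      let ?G = "\<lambda>l u. coef l * mon (ents l) (probe t u) * (a l + 2 * b l * probe t u l)"
      have "2 * (K * t\<^sup>2) = - (?E 1 + ?E (- 1) - 2 * ?E 0)"
        using eq[of t 1] eq[of t "- 1"] eq[of t 0] by simp
      then have "2 * \<bar>K\<bar> * t\<^sup>2 = \<bar>?E 1 + ?E (- 1) - 2 * ?E 0\<bar>"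
        by (metis abs_minus_cancel abs_mult abs_numeral abs_power2 mult.assoc)
      also have "?E 1 + ?E (- 1) - 2 * ?E 0 = (\<Sum>l=3..n. ?G l 1 + ?G l (- 1) - 2 * ?G l 0)"
        unfolding ansatz_drift_def by (simp add: sum.distrib sum_subtractf sum_distrib_left)
      also have "\<bar>\<dots>\<bar> \<le> (\<Sum>l=3..n. 4 * \<bar>coef l * a l\<bar> * t ^ 3)"
        by (rule sum_abs[THEN order_trans], rule sum_mono, rule second_difference_le)
          (use t assms in auto)
      also have "\<dots> = D * t ^ 3" by (simp add: D_def sum_distrib_right)
      finally show ?thesis .
    qed
    \<comment> \<open>Small enough that \<open>D * t \<le> \<bar>K\<bar>\<close>; the added 1 keeps
      the denominator positive when \<open>D = 0\<close>.\<close>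
    define t where "t = min 1 (\<bar>K\<bar> / (D + 1))"
    have t: "0 < t" "t \<le> 1" using K D by (auto simp: t_def)
    have "2 * \<bar>K\<bar> * t\<^sup>2 \<le> (D * t) * t\<^sup>2"
      using bound[of t] t by (simp add: power2_eq_square power3_eq_cube mult.assoc)
    then have "2 * \<bar>K\<bar> \<le> D * t" using t by simp
    also have "\<dots> \<le> D * (\<bar>K\<bar> / (D + 1))" using D by (intro mult_left_mono) (auto simp: t_def)
    also have "\<dots> \<le> \<bar>K\<bar>" using D by (simp add: field_simps)
    finally show False using K by simp
  qed
  then show ?thesis using j(1) by blast
qed

end

theorem theorem4p1:
  fixes s n :: nat
    and br :: "'f::real_vector \<Rightarrow> 'f \<Rightarrow> 'f"
    and X :: "nat \<Rightarrow> hall_expr"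
  assumes "s \<ge> 2"
    and "free_nilpotent2 s br"
    and "n = dim (UNIV :: 'f set)"
    and "hall_basis s n X"
  shows "(s \<le> 8 \<longrightarrow> (\<forall>j\<in>{3..n}. \<exists>a b. solves_eq n X j (ansatz n a b) \<and>
            (s \<le> 5 \<longrightarrow> (\<forall>l\<in>{3..n}. b l = 0)))) \<and>
         (s \<ge> 9 \<longrightarrow> (\<exists>j\<in>{3..n}. \<forall>a b. \<not> solves_eq n X j (ansatz n a b)))"
proof -
  obtain lt where "hall_numbering s n X lt"
    using assms(1,4) unfolding hall_basis_def hall_numbering_def by blast
  then interpret hall_numbering s n X lt .
  show ?thesis using solvable unsolvable by blast
qed

end
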